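(* For every integer $n\ge1$, every $\lambda\in(0,1]$ and every $\alpha>0$, $$\inf_{X\in\mathcal{D}_n}\big\{d_\alpha\big(X,Z(\lambda)\big)\big\}=d_\alpha\big(Z_n(\lambda),Z(\lambda)\big).$$
   Context: $\mathcal{D}_n$ is the set of random variables $X$ with $\mathbb{P}(X\in\{0,1,\ldots,n\})=1$. For $x\in\mathbb{R}$ let $(x)_0=1$ and $(x)_k=x(x-1)\cdots(x-k+1)$ for $k=1,2,\ldots$; $\mathbb{E}(X)_k$ denotes the expectation of $(X)_k$. For $\alpha>0$ and random variables $X_1,X_2$ with values in $\{0,1,2,\ldots\}$ such that $\mathbb{E}[(1+t')^{X_i}]<\infty$ for some $t'>0$ ($i=1,2$), the factorial moment distance of order $\alpha$ is $$d_\alpha(X_1,X_2):=\sum_{k=1}^{\infty}\frac{\alpha^{k-1}}{k!}\big|\mathbb{E}(X_1)_k-\mathbb{E}(X_2)_k\big|\in[0,\infty].$$ For $n\ge1$ and $\lambda\in(0,1]$, the random variable $Z_n(\lambda)$ (generalized matching distribution) is defined by $Z_n(\lambda)=\sum_{i=1}^n J_i\,\mathbf{1}\{\pi_n(i)=i\}$, where $\pi_n$ is a uniformly random permutation of $\{1,\ldots,n\}$ and $J_1,\ldots,J_n$ are i.i.d. Bernoulli($\lambda$) random variables independent of $\pi_n$; equivalently, its probability mass function is $$\mathbb{P}(Z_n(\lambda)=j)=\frac{\lambda^j}{j!}\sum_{i=0}^{n-j}\frac{(-\lambda)^i}{i!},\qquad j=0,1,\ldots,n.$$ $Z(\lambda)$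 is a Poisson random variable with mean $\lambda$. *)

theory Defs
  imports "HOL-Probability.Probability" "HOL-Combinatorics.Permutations" "HOL-Library.Monad_Syntax"
begin

text \<open>
  All notions below depend only on the laws of the random variables involved, and these variables
  take values in the natural numbers almost surely. A random variable is therefore represented by
  its law, of type \<^typ>\<open>nat pmf\<close>.
\<close>

definition falling_factorial :: "real \<Rightarrow> nat \<Rightarrow> real" where
  "falling_factorial x k = (\<Prod>i<k. x - real i)"

definition factorial_moment :: "nat pmf \<Rightarrow> nat \<Rightarrow> real" where
  "factorial_moment p k = measure_pmf.expectation p (\<lambda>x. falling_factorial (real x) k)"

text \<open>
  The class of laws between which the factorial moment distance is considered. It guarantees that
  all factorial moments exist, so that the Bochner integral in the definition of
  \<^const>\<open>factorial_moment\<close> does not take its default value 0.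
\<close>

definition fmd_admissible :: "nat pmf \<Rightarrow> bool" where
  "fmd_admissible p \<longleftrightarrow> (\<exists>t>0. integrable (measure_pmf p) (\<lambda>x. (1 + t :: real) ^ x))"

text \<open>
  The series runs over \<open>k \<ge> 1\<close>; below it is indexed by \<open>k - 1\<close>. Its value may be infinite. The
  definition is total, but meaningful only for admissible laws; the lemmas at the end of this theory
  show that all laws in the set \<open>\<D>\<close> and the Poisson laws are admissible.
\<close>

definition factorial_moment_dist :: "real \<Rightarrow> nat pmf \<Rightarrow> nat pmf \<Rightarrow> ennreal" where
  "factorial_moment_dist \<alpha> p q =
     (\<Sum>k. ennreal (\<alpha> ^ k / fact (Suc k) *
              \<bar>factorial_moment p (Suc k) - factorial_moment q (Suc k)\<bar>))"

definition \<D> :: "nat \<Rightarrow> nat pmf set" where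
  "\<D> n = {p. measure_pmf.prob p {0..n} = 1}"

text \<open>
  The two draws are independent, as are the coordinates of \<open>J\<close>; the value \<open>False\<close> is only the
  default of \<open>J\<close> outside \<open>{1..n}\<close>.
\<close>

definition matching_pmf :: "nat \<Rightarrow> real \<Rightarrow> nat pmf" where
  "matching_pmf n lam =
     do {
       \<pi> \<leftarrow> pmf_of_set {\<pi>. \<pi> permutes {1..n}};
       J \<leftarrow> Pi_pmf {1..n} False (\<lambda>_. bernoulli_pmf lam);
       return_pmf (\<Sum>i=1..n. of_bool (J i) * of_bool (\<pi> i = i))
     }"

lemma fmd_admissible_\<D>:
  assumes "p \<in> \<D> n"
  shows "fmd_admissible p"
proof -
  have "AE x in measure_pmf p. x \<in> {0..n}"
    using assms by (simp add: \<D>_def measure_pmf.prob_eq_1)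
  hence "set_pmf p \<subseteq> {0..n}"
    by (auto simp: AE_measure_pmf_iff)
  hence "finite (set_pmf p)"
    using finite_subset by blast
  thus ?thesis
    unfolding fmd_admissible_def
    by (intro exI[of _ 1]) (auto intro: integrable_measure_pmf_finite)
qed

lemma matching_pmf_in_\<D>: "matching_pmf n lam \<in> \<D> n"
proof -
  have "(\<Sum>i=1..n. of_bool (J i) * of_bool (\<pi> i = i)) \<le> n" for J and \<pi> :: "nat \<Rightarrow> nat"
    using sum_bounded_above[of "{1..n}" "\<lambda>i. of_bool (J i) * of_bool (\<pi> i = i)" "1 :: nat"]
    by simp
  hence "AE x in measure_pmf (matching_pmf n lam). x \<in> {0..n}"
    by (auto simp: AE_measure_pmf_iff matching_pmf_def set_bind_pmf)
  thus ?thesis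
    by (simp add: \<D>_def measure_pmf.prob_eq_1)
qed

lemma fmd_admissible_poisson:
  assumes "lam > 0"
  shows "fmd_admissible (poisson_pmf lam)"
proof -
  have "summable (\<lambda>k. exp (-lam) * ((2 * lam) ^ k / fact k))"
    using summable_exp_generic[of "2 * lam"]
    by (intro summable_mult) (simp add: divide_inverse mult.commute)
  hence "integrable (count_space UNIV) (\<lambda>k. pmf (poisson_pmf lam) k * (1 + 1) ^ k)"
    using assms
    by (subst integrable_count_space_nat_iff) (simp add: field_simps power_mult_distrib)
  hence "integrable (measure_pmf (poisson_pmf lam)) (\<lambda>x. (1 + 1 :: real) ^ x)"
    by (subst measure_pmf_eq_density, subst integrable_density) auto
  thus ?thesis
    unfolding fmd_admissible_def by (intro exI[of _ 1]) auto
qed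

end

theory Submission
  imports Defs
begin

text \<open>
  A law on \<open>{0..n}\<close> has vanishing factorial moments of all orders \<open>k > n\<close>, so the terms of the
  distance with \<open>k > n\<close> do not depend on \<open>X\<close>. The factorial moments of order \<open>k \<le> n\<close> of
  \<open>Z\<^sub>n(\<lambda>)\<close> are \<open>\<lambda>\<^sup>k\<close>, which are those of the Poisson law, so its terms with \<open>k \<le> n\<close> vanish.
\<close>

lemma falling_factorial_of_nat: "falling_factorial (real x) k = fact k * real (x choose k)"
  by (simp add: falling_factorial_def binomial_gbinomial gbinomial_prod_rev atLeast0LessThan)

lemma factorial_moment_eq_0:
  assumes "p \<in> \<D> n" "n < k"
  shows "factorial_moment p k = 0"
proof -
  have "AE x in measure_pmf p. x \<in> {0..n}"
    using assms(1) by (simp add: \<D>_def measure_pmf.prob_eq_1)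
  hence "AE x in measure_pmf p. falling_factorial (real x) k = 0"
    using assms(2) by (auto simp: AE_measure_pmf_iff falling_factorial_of_nat)
  thus ?thesis
    unfolding factorial_moment_def by (rule integral_eq_zero_AE)
qed

text \<open>The falling factorial cancels against the factorial in the Poisson weight, so what
  remains is \<open>lam ^ k\<close> times a normalised exponential series shifted by
  \<open>k\<close>.\<close>

lemma factorial_moment_poisson:
  assumes "lam > 0"
  shows "factorial_moment (poisson_pmf lam) k = lam ^ k"
proof -
  define f where "f j = pmf (poisson_pmf lam) j * falling_factorial (real j) k" for j
  have shift: "f (j + k) = lam ^ k * exp (-lam) * (lam ^ j / fact j)" for j
    using assms unfolding f_def
    by (simp add: falling_factorial_of_nat binomial_fact power_add field_simps del: of_nat_add)
  have "(\<lambda>j. lam ^ j / fact j) sums exp lam"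
    using exp_converges[of lam] by (simp add: field_simps)
  hence "(\<lambda>j. lam ^ k * exp (-lam) * (lam ^ j / fact j)) sums (lam ^ k * exp (-lam) * exp lam)"
    by (rule sums_mult)
  hence "(\<lambda>j. f (j + k)) sums (lam ^ k)"
    by (simp add: shift mult.assoc flip: exp_add)
  \<comment> \<open>The first \<open>k\<close> terms vanish, so undoing the shift adds nothing to
    the sum.\<close>
  moreover have "f j = 0" if "j < k" for j
    using that by (simp add: f_def falling_factorial_of_nat)
  ultimately have sums: "f sums (lam ^ k)"
    using sums_iff_shift'[of f k "lam ^ k"] by simp
  have nonneg: "f j \<ge> 0" for j
    by (simp add: f_def falling_factorial_of_nat)
  \<comment> \<open>Integrability excludes the default value 0 of the Bochner integral and lets it
    be read as the series.\<close>
  have int: "integrable (count_space UNIV) f"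
    using sums nonneg by (simp add: integrable_count_space_nat_iff sums_iff)
  have "factorial_moment (poisson_pmf lam) k = (\<integral>j. f j \<partial>count_space UNIV)"
    unfolding factorial_moment_def f_def
    by (subst measure_pmf_eq_density, subst integral_density) auto
  also have "\<dots> = lam ^ k"
    using integral_count_space_nat[OF int] sums by (simp add: sums_iff)
  finally show ?thesis .
qed

text \<open>Turns the binomial coefficient of a random count into a sum of indicators over fixed
  index sets, to which linearity of expectation applies.\<close>

lemma card_choose_eq_sum:
  assumes "finite U"
  shows "real (card {i \<in> U. P i} choose k) =
    (\<Sum>S | S \<subseteq> U \<and> card S = k. of_bool (\<forall>i\<in>S. P i))"
proof -
  have "real (card {i \<in> U. P i} choose k) = real (card {S. S \<subseteq> {i \<in> U. P i} \<and> card S = k})"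
    using assms by (subst n_subsets) auto
  also have "{S. S \<subseteq> {i \<in> U. P i} \<and> card S = k} =
      {S. S \<subseteq> U \<and> card S = k} \<inter> {S. \<forall>i\<in>S. P i}"
    by auto
  also have "real (card \<dots>) = (\<Sum>S | S \<subseteq> U \<and> card S = k. of_bool (\<forall>i\<in>S. P i))"
    using assms by (simp add: of_bool_def sum.If_cases)
  finally show ?thesis .
qed

text \<open>Since \<open>permutes\<close> demands the identity off the given set, fixing
  \<open>S\<close> pointwise just shrinks that set; no restriction of functions is involved.\<close>

lemma permutations_fixing_eq:
  assumes "S \<subseteq> U"
  shows "{\<pi>. \<pi> permutes U} \<inter> {\<pi>. \<forall>i\<in>S. \<pi> i = i} = {\<pi>. \<pi> permutes (U - S)}"
proof (intro set_eqI iffI)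
  fix \<pi> assume "\<pi> \<in> {\<pi>. \<pi> permutes U} \<inter> {\<pi>. \<forall>i\<in>S. \<pi> i = i}"
  thus "\<pi> \<in> {\<pi>. \<pi> permutes (U - S)}"
    by (auto intro: permutes_superset)
next
  fix \<pi> assume "\<pi> \<in> {\<pi>. \<pi> permutes (U - S)}"
  hence "\<pi> permutes (U - S)" by simp
  thus "\<pi> \<in> {\<pi>. \<pi> permutes U} \<inter> {\<pi>. \<forall>i\<in>S. \<pi> i = i}"
    using permutes_subset[of \<pi> "U - S" U] by (auto simp: permutes_not_in)
qed

lemma expectation_permutation_fixes:
  assumes "finite U" "S \<subseteq> U"
  shows "measure_pmf.expectation (pmf_of_set {\<pi>. \<pi> permutes U}) (\<lambda>\<pi>. of_bool (\<forall>i\<in>S. \<pi> i = i)) =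
    (fact (card U - card S) / fact (card U) :: real)"
proof -
  have fin: "finite {\<pi>. \<pi> permutes U}"
    using assms(1) by (rule finite_permutations)
  have ne: "{\<pi>. \<pi> permutes U} \<noteq> {}"
    using permutes_id by blast
  have "measure_pmf.expectation (pmf_of_set {\<pi>. \<pi> permutes U}) (\<lambda>\<pi>. of_bool (\<forall>i\<in>S. \<pi> i = i)) =
      real (card ({\<pi>. \<pi> permutes U} \<inter> {\<pi>. \<forall>i\<in>S. \<pi> i = i})) / card {\<pi>. \<pi> permutes U}"
    using fin ne by (simp add: integral_pmf_of_set of_bool_def sum.If_cases)
  also have "\<dots> = fact (card U - card S) / fact (card U)"
    using assms by (simp add: permutations_fixing_eq card_permutations card_Diff_subset
        finite_subset[OF assms(2)])
  finally show ?thesis .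
qed

lemma expectation_bernoulli_all:
  assumes "finite U" "S \<subseteq> U" "0 \<le> lam" "lam \<le> 1"
  shows "measure_pmf.expectation (Pi_pmf U False (\<lambda>_. bernoulli_pmf lam))
    (\<lambda>J. of_bool (\<forall>i\<in>S. J i)) = lam ^ card S"
proof -
  \<comment> \<open>As a product event, with coordinates outside \<open>S\<close> unconstrained, its
    probability factors by independence.\<close>
  have "(\<lambda>J. of_bool (\<forall>i\<in>S. J i) :: real) = indicator (Pi U (\<lambda>i. if i \<in> S then {True} else UNIV))"
    using assms(2) by (auto simp: fun_eq_iff indicator_def Pi_def)
  hence "measure_pmf.expectation (Pi_pmf U False (\<lambda>_. bernoulli_pmf lam))
      (\<lambda>J. of_bool (\<forall>i\<in>S. J i)) =
      (\<Prod>i\<in>U. measure_pmf.prob (bernoulli_pmf lam) (if i \<in> S then {True} else UNIV))"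
    using assms(1) by (simp add: measure_Pi_pmf_Pi)
  also have "\<dots> = (\<Prod>i\<in>U. if i \<in> S then lam else 1)"
    using assms by (intro prod.cong) (auto simp: measure_pmf_single)
  also have "\<dots> = lam ^ card S"
    using assms by (simp add: prod.If_cases Int_absorb1)
  finally show ?thesis .
qed

text \<open>
  The binomial coefficient \<open>Z\<^sub>n choose k\<close> counts the \<open>k\<close>-subsets of \<open>{1..n}\<close> on which the permutation
  is the identity and all coins show success.
\<close>

lemma factorial_moment_matching:
  assumes "0 \<le> lam" "lam \<le> 1" "k \<le> n"
  shows "factorial_moment (matching_pmf n lam) k = lam ^ k"
proof -
  define P where "P = pmf_of_set {\<pi>. \<pi> permutes {1..n}}"
  define B where "B = Pi_pmf {1..n} False (\<lambda>_. bernoulli_pmf lam)"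
  define F where "F \<pi> J = (\<Sum>i=1..n. of_bool (J i) * of_bool (\<pi> i = i) :: nat)"
    for \<pi> :: "nat \<Rightarrow> nat" and J
  \<comment> \<open>Finite supports make every function integrable, so the expectations below may be
    iterated and exchanged with sums.\<close>
  have finP: "finite (set_pmf P)"
    unfolding P_def using permutes_id
    by (subst set_pmf_of_set) (blast intro: finite_permutations)+
  have finB: "finite (set_pmf B)"
    unfolding B_def by (subst set_Pi_pmf) (auto intro!: finite_PiE_dflt)
  \<comment> \<open>The conditions on \<open>\<pi>\<close> and on \<open>J\<close> stay in separate
    factors, so that each expectation acts on its own factor.\<close>
  have F: "falling_factorial (real (F \<pi> J)) k = fact k *
      (\<Sum>S | S \<subseteq> {1..n} \<and> card S = k. of_bool (\<forall>i\<in>S. \<pi> i = i) * of_bool (\<forall>i\<in>S. J i))"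
    for \<pi> J
  proof -
    have "F \<pi> J = (\<Sum>i=1..n. of_bool (\<pi> i = i \<and> J i))"
      by (simp only: F_def of_bool_conj mult.commute)
    also have "\<dots> = card {i \<in> {1..n}. \<pi> i = i \<and> J i}"
      by (simp add: of_bool_def sum.If_cases Int_def)
    finally have "F \<pi> J = card {i \<in> {1..n}. \<pi> i = i \<and> J i}" .
    thus ?thesis
      by (simp only: falling_factorial_of_nat card_choose_eq_sum finite_atLeastAtMost
          ball_conj_distrib of_bool_conj)
  qed
  have "matching_pmf n lam = bind_pmf P (\<lambda>\<pi>. map_pmf (F \<pi>) B)"
    by (simp add: matching_pmf_def P_def B_def F_def map_pmf_def)
  hence "factorial_moment (matching_pmf n lam) k =
      measure_pmf.expectation P (\<lambda>\<pi>. measure_pmf.expectation B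
        (\<lambda>J. falling_factorial (real (F \<pi> J)) k))"
    unfolding factorial_moment_def using finP finB
    by (simp add: pmf_expectation_bind[of "set_pmf P"] integral_measure_pmf[of "set_pmf P"])
  also have "\<dots> = fact k * (\<Sum>S | S \<subseteq> {1..n} \<and> card S = k.
      measure_pmf.expectation P (\<lambda>\<pi>. of_bool (\<forall>i\<in>S. \<pi> i = i)) *
      measure_pmf.expectation B (\<lambda>J. of_bool (\<forall>i\<in>S. J i)))"
    using finP finB
    \<comment> \<open>The deleted rules simplify sums of indicators, whereas linearity needs the sum
      over \<open>S\<close> in its present form.\<close>
    by (simp add: F Bochner_Integration.integral_sum integrable_measure_pmf_finite
        del: sum_of_bool_eq sum_mult_of_bool_eq sum_of_bool_mult_eq)
  also have "\<dots> = fact k * (\<Sum>S | S \<subseteq> {1..n} \<and> card S = k. fact (n - k) / fact n * lam ^ k)"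
    unfolding P_def B_def using assms
    by (intro arg_cong2[where f = "(*)"] sum.cong refl)
      (auto simp: expectation_permutation_fixes expectation_bernoulli_all)
  \<comment> \<open>The summand depends on \<open>S\<close> only through its size; the number of
    such sets then cancels all factorials, as \<open>k \<le> n\<close>.\<close>
  also have "\<dots> = fact k * (real (n choose k) * (fact (n - k) / fact n * lam ^ k))"
    by (simp add: n_subsets)
  also have "\<dots> = lam ^ k"
    using assms(3) by (simp add: binomial_fact)
  finally show ?thesis .
qed

theorem corollary3p1:
  fixes n :: nat and lam \<alpha> :: real
  assumes "n \<ge> 1" and "0 < lam" and "lam \<le> 1" and "\<alpha> > 0"
  shows "(INF X \<in> \<D> n. factorial_moment_dist \<alpha> X (poisson_pmf lam)) =
         factorial_moment_dist \<alpha> (matching_pmf n lam) (poisson_pmf lam)"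
proof (rule antisym)
  show "(INF X \<in> \<D> n. factorial_moment_dist \<alpha> X (poisson_pmf lam)) \<le>
      factorial_moment_dist \<alpha> (matching_pmf n lam) (poisson_pmf lam)"
    by (rule INF_lower[OF matching_pmf_in_\<D>])
  show "factorial_moment_dist \<alpha> (matching_pmf n lam) (poisson_pmf lam) \<le>
      (INF X \<in> \<D> n. factorial_moment_dist \<alpha> X (poisson_pmf lam))"
  proof (rule INF_greatest)
    fix X assume X: "X \<in> \<D> n"
    \<comment> \<open>The matching law minimises every term separately: the left side is 0 for
      \<open>k \<le> n\<close>, and both sides agree for \<open>k > n\<close>.\<close>
    have "\<bar>factorial_moment (matching_pmf n lam) k - factorial_moment (poisson_pmf lam) k\<bar> \<le>
        \<bar>factorial_moment X k - factorial_moment (poisson_pmf lam) k\<bar>" for k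
    proof (cases "k \<le> n")
      case True
      thus ?thesis
        using assms by (simp add: factorial_moment_matching factorial_moment_poisson)
    next
      case False
      thus ?thesis
        using X by (simp add: factorial_moment_eq_0[of _ n] matching_pmf_in_\<D>)
    qed
    thus "factorial_moment_dist \<alpha> (matching_pmf n lam) (poisson_pmf lam) \<le>
        factorial_moment_dist \<alpha> X (poisson_pmf lam)"
      unfolding factorial_moment_dist_def using assms
      by (intro suminf_le summableI ennreal_leI mult_left_mono) auto
  qed
qed

end
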